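(* Let $(V;l_{\rhd}, r_{\rhd}, l_{\lhd}, r_{\lhd})$ be a bimodule of a dialgebra $(A,\rhd,\lhd)$. Then: (a) $(V;l_{\rhd}, 0, l_{\lhd}, 0)$ and $(V;0,r_{\rhd},0, r_{\lhd})$ are bimodules of $(A,\rhd,\lhd)$. (b) $(V^*;\,-r_{\lhd}^{*},\ l_{\lhd}^{*}-l_{\rhd}^{*},\ r_{\rhd}^{*}-r_{\lhd}^{*},\ -l_{\rhd}^{*})$ is a bimodule of $(A,\rhd,\lhd)$. Moreover, the direct sum $A\oplus V^*$ of vector spaces is a dialgebra under the products (for $x,y\in A$, $u^*,v^*\in V^*$) $$(x+u^* )\rhd (y+v^* )=x\rhd y-r_{\lhd}^{*}(x)v^*+(l_{\lhd}^{*}-l_{\rhd}^{*})(y)u^*,$$ $$(x+u^* )\lhd (y+v^* )=x\lhd y+(r_{\rhd}^{*}-r_{\lhd}^{*})(x)v^*-l_{\rhd}^{*}(y)u^*.$$ (c) $(V^*;\,0,\ l_{\lhd}^{*}-l_{\rhd}^{*},\ 0,\ -l_{\rhd}^{*})$ and $(V^*;\,-r_{\lhd}^{*},\ 0,\ r_{\rhd}^{*}-r_{\lhd}^{*},\ 0)$ are bimodules of $(A,\rhd,\lhd)$.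
   Context: All vector spaces and algebras are finite-dimensional over a field $\mathbb F$ of characteristic $0$; algebras are not assumed unital. A dialgebra is a triple $(A,\rhd,\lhd)$ where $A$ is a vector space and $\rhd,\lhd$ are associative bilinear products on $A$ such that for all $x,y,z\in A$: $(x\lhd y)\lhd z=x\lhd(y\rhd z)$, $(x\rhd y)\lhd z=x\rhd(y\lhd z)$, $(x\lhd y)\rhd z=x\rhd(y\rhd z)$. A bimodule of an associative algebra $(A,\cdot)$ is a triple $(V;l,r)$ with $V$ a vector space and $l,r:A\to\mathrm{End}(V)$ linear with $l(x\cdot y)=l(x)l(y)$, $r(x\cdot y)=r(y)r(x)$, $l(x)r(y)=r(y)l(x)$. A bimodule of a dialgebra $(A,\rhd,\lhd)$ is a quintuple $(V;l_{\rhd}, r_{\rhd}, l_{\lhd}, r_{\lhd})$ where $(V;l_{\rhd}, r_{\rhd})$ and $(V;l_{\lhd}, r_{\lhd})$ are bimodules of the associative algebras $(A,\rhd)$ and $(A,\lhd)$ respectively, and for all $x,y\in A$: $r_{\lhd}(x\lhd y)=r_{\lhd}(x\rhd y)$, $l_{\lhd}(x)r_{\lhd}(y)=l_{\lhd}(x)r_{\rhd}(y)$, $l_{\lhd}(x)l_{\lhd}(y)=l_{\lhd}(x)l_{\rhd}(y)$, $r_{\lhd}(x)r_{\rhd}(y)=r_{\rhd}(y\lhd x)$, $r_{\lhd}(x)l_{\rhd}(y)=l_{\rhd}(y)r_{\lhd}(x)$, $l_{\lhd}(x\rhd y)=l_{\rhd}(x)l_{\lhd}(y)$, $r_{\rhd}(x)r_{\lhd}(y)=r_{\rhd}(x)r_{\rhd}(y)$,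 $r_{\rhd}(x)l_{\lhd}(y)=r_{\rhd}(x)l_{\rhd}(y)$, $l_{\rhd}(x\lhd y)=l_{\rhd}(x\rhd y)$. For a linear map $\varphi:A\to\mathrm{End}(V)$, define $\varphi^*:A\to\mathrm{End}(V^* )$ by $\langle\varphi^*(x)v^*,u\rangle=-\langle v^*,\varphi(x)u\rangle$ (note the sign). *)

theory Defs
  imports "HOL-Analysis.Product_Vector" "HOL-Library.Function_Algebras"
begin

text \<open>
  A vector space is a subspace \<open>V\<close>, finite-dimensional, of an arbitrary ambient vector space
  (a type with a scalar multiplication, not itself required to be finite-dimensional). Carriers
  are needed because the dual space depends on the scalar multiplication, so that it is
  a set of functions and not a type. All conditions are relative to the carriers.
\<close>

locale fd_space = vector_space scale
  for scale :: "'f::field_char_0 \<Rightarrow> 'v::ab_group_add \<Rightarrow> 'v" +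
  fixes V :: "'v set"
  assumes finite_spanning_set: "\<exists>B. finite B \<and> span B = V"

definition linear_on ::
  "('f \<Rightarrow> 'v \<Rightarrow> 'v::ab_group_add) \<Rightarrow> 'v set \<Rightarrow> ('f::field_char_0 \<Rightarrow> 'w \<Rightarrow> 'w::ab_group_add) \<Rightarrow> 'w set
    \<Rightarrow> ('v \<Rightarrow> 'w) \<Rightarrow> bool" where
  "linear_on sV V sW W f \<longleftrightarrow>
    (\<forall>x\<in>V. f x \<in> W) \<and>
    (\<forall>x\<in>V. \<forall>y\<in>V. f (x + y) = f x + f y) \<and>
    (\<forall>c. \<forall>x\<in>V. f (sV c x) = sW c (f x))"

locale assoc_algebra = fd_space scale A
  for scale :: "'f::field_char_0 \<Rightarrow> 'a::ab_group_add \<Rightarrow> 'a" and A :: "'a set" +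
  fixes mult :: "'a \<Rightarrow> 'a \<Rightarrow> 'a"
  assumes linear_right: "x \<in> A \<Longrightarrow> linear_on scale A scale A (\<lambda>y. mult x y)"
    and linear_left: "y \<in> A \<Longrightarrow> linear_on scale A scale A (\<lambda>x. mult x y)"
    and assoc: "\<lbrakk>x \<in> A; y \<in> A; z \<in> A\<rbrakk> \<Longrightarrow> mult (mult x y) z = mult x (mult y z)"

locale dialgebra =
  R: assoc_algebra scale A rmult + L: assoc_algebra scale A lmult
  for scale :: "'f::field_char_0 \<Rightarrow> 'a::ab_group_add \<Rightarrow> 'a" and A :: "'a set"
    and rmult :: "'a \<Rightarrow> 'a \<Rightarrow> 'a"  (infixl "\<rhd>" 70)
    and lmult :: "'a \<Rightarrow> 'a \<Rightarrow> 'a"  (infixl "\<lhd>" 70) +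
  assumes "\<lbrakk>x \<in> A; y \<in> A; z \<in> A\<rbrakk> \<Longrightarrow> (x \<lhd> y) \<lhd> z = x \<lhd> (y \<rhd> z)"
    and "\<lbrakk>x \<in> A; y \<in> A; z \<in> A\<rbrakk> \<Longrightarrow> (x \<rhd> y) \<lhd> z = x \<rhd> (y \<lhd> z)"
    and "\<lbrakk>x \<in> A; y \<in> A; z \<in> A\<rbrakk> \<Longrightarrow> (x \<lhd> y) \<rhd> z = x \<rhd> (y \<rhd> z)"

text \<open>
  \<open>\<phi>\<close> restricts to a linear map from \<open>A\<close> to \<open>End V\<close>. Only the values \<open>\<phi> x v\<close> with
  \<open>x \<in> A\<close> and \<open>v \<in> V\<close> matter, hence the equations in \<open>End V\<close> are tested on vectors of \<open>V\<close>.
\<close>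

definition linear_into_End ::
  "('f \<Rightarrow> 'a \<Rightarrow> 'a::ab_group_add) \<Rightarrow> 'a set \<Rightarrow> ('f::field_char_0 \<Rightarrow> 'v \<Rightarrow> 'v::ab_group_add) \<Rightarrow> 'v set
    \<Rightarrow> ('a \<Rightarrow> 'v \<Rightarrow> 'v) \<Rightarrow> bool" where
  "linear_into_End sA A sV V \<phi> \<longleftrightarrow>
    (\<forall>x\<in>A. linear_on sV V sV V (\<phi> x)) \<and>
    (\<forall>x\<in>A. \<forall>y\<in>A. \<forall>v\<in>V. \<phi> (x + y) v = \<phi> x v + \<phi> y v) \<and>
    (\<forall>c. \<forall>x\<in>A. \<forall>v\<in>V. \<phi> (sA c x) v = sV c (\<phi> x v))"

locale assoc_bimodule =
  alg: assoc_algebra sA A mult + fd_space sV V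
  for sA :: "'f::field_char_0 \<Rightarrow> 'a::ab_group_add \<Rightarrow> 'a" and A :: "'a set"
    and mult :: "'a \<Rightarrow> 'a \<Rightarrow> 'a"
    and sV :: "'f \<Rightarrow> 'v::ab_group_add \<Rightarrow> 'v" and V :: "'v set" +
  fixes l r :: "'a \<Rightarrow> 'v \<Rightarrow> 'v"
  assumes "linear_into_End sA A sV V l"
    and "linear_into_End sA A sV V r"
    and "\<lbrakk>x \<in> A; y \<in> A; v \<in> V\<rbrakk> \<Longrightarrow> l (mult x y) v = l x (l y v)"
    and "\<lbrakk>x \<in> A; y \<in> A; v \<in> V\<rbrakk> \<Longrightarrow> r (mult x y) v = r y (r x v)"
    and "\<lbrakk>x \<in> A; y \<in> A; v \<in> V\<rbrakk> \<Longrightarrow> l x (r y v) = r y (l x v)"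

text \<open>The index \<open>R\<close> refers to \<open>\<rhd>\<close> and the index \<open>L\<close> to \<open>\<lhd>\<close>.\<close>

locale dialgebra_bimodule =
  dialgebra sA A rmult lmult +
  RV: assoc_bimodule sA A rmult sV V l\<^sub>R r\<^sub>R + LV: assoc_bimodule sA A lmult sV V l\<^sub>L r\<^sub>L
  for sA :: "'f::field_char_0 \<Rightarrow> 'a::ab_group_add \<Rightarrow> 'a" and A :: "'a set"
    and rmult :: "'a \<Rightarrow> 'a \<Rightarrow> 'a"  (infixl "\<rhd>" 70)
    and lmult :: "'a \<Rightarrow> 'a \<Rightarrow> 'a"  (infixl "\<lhd>" 70)
    and sV :: "'f \<Rightarrow> 'v::ab_group_add \<Rightarrow> 'v" and V :: "'v set"
    and l\<^sub>R r\<^sub>R l\<^sub>L r\<^sub>L :: "'a \<Rightarrow> 'v \<Rightarrow> 'v" +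
  assumes "\<lbrakk>x \<in> A; y \<in> A; v \<in> V\<rbrakk> \<Longrightarrow> r\<^sub>L (x \<lhd> y) v = r\<^sub>L (x \<rhd> y) v"
    and "\<lbrakk>x \<in> A; y \<in> A; v \<in> V\<rbrakk> \<Longrightarrow> l\<^sub>L x (r\<^sub>L y v) = l\<^sub>L x (r\<^sub>R y v)"
    and "\<lbrakk>x \<in> A; y \<in> A; v \<in> V\<rbrakk> \<Longrightarrow> l\<^sub>L x (l\<^sub>L y v) = l\<^sub>L x (l\<^sub>R y v)"
    and "\<lbrakk>x \<in> A; y \<in> A; v \<in> V\<rbrakk> \<Longrightarrow> r\<^sub>L x (r\<^sub>R y v) = r\<^sub>R (y \<lhd> x) v"
    and "\<lbrakk>x \<in> A; y \<in> A; v \<in> V\<rbrakk> \<Longrightarrow> r\<^sub>L x (l\<^sub>R y v) = l\<^sub>R y (r\<^sub>L x v)"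
    and "\<lbrakk>x \<in> A; y \<in> A; v \<in> V\<rbrakk> \<Longrightarrow> l\<^sub>L (x \<rhd> y) v = l\<^sub>R x (l\<^sub>L y v)"
    and "\<lbrakk>x \<in> A; y \<in> A; v \<in> V\<rbrakk> \<Longrightarrow> r\<^sub>R x (r\<^sub>L y v) = r\<^sub>R x (r\<^sub>R y v)"
    and "\<lbrakk>x \<in> A; y \<in> A; v \<in> V\<rbrakk> \<Longrightarrow> r\<^sub>R x (l\<^sub>L y v) = r\<^sub>R x (l\<^sub>R y v)"
    and "\<lbrakk>x \<in> A; y \<in> A; v \<in> V\<rbrakk> \<Longrightarrow> l\<^sub>R (x \<lhd> y) v = l\<^sub>R (x \<rhd> y) v"

text \<open>
  Addition, negation and zero on functions are the pointwise ones. Linear forms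
  on \<open>V\<close> are extended by \<open>0\<close> outside \<open>V\<close>, which gives each form a unique representative.
\<close>

definition scale_fun :: "'f \<Rightarrow> ('v \<Rightarrow> 'f) \<Rightarrow> 'v \<Rightarrow> 'f::field_char_0" where
  "scale_fun c f = (\<lambda>v. c * f v)"

definition dual_space ::
  "('f::field_char_0 \<Rightarrow> 'v::ab_group_add \<Rightarrow> 'v) \<Rightarrow> 'v set \<Rightarrow> ('v \<Rightarrow> 'f) set" where
  "dual_space sV V = {f. linear_on sV V (*) UNIV f \<and> (\<forall>v. v \<notin> V \<longrightarrow> f v = 0)}"

definition dual_map ::
  "'v set \<Rightarrow> ('a \<Rightarrow> 'v \<Rightarrow> 'v) \<Rightarrow> 'a \<Rightarrow> ('v \<Rightarrow> 'f) \<Rightarrow> 'v \<Rightarrow> 'f::field_char_0" where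
  "dual_map V \<phi> x f = (\<lambda>u. if u \<in> V then - f (\<phi> x u) else 0)"

end

theory Submission
  imports Defs
begin

text \<open>
  As \<open>\<langle>\<phi>\<^sup>*(x)f, u\<rangle> = -\<langle>f, \<phi>(x)u\<rangle>\<close>, the four maps of the dual bimodule are, with the signs cancelled,
  the transposes of \<open>r\<^sub>L\<close>, \<open>l\<^sub>R - l\<^sub>L\<close>, \<open>r\<^sub>L - r\<^sub>R\<close> and \<open>l\<^sub>R\<close>. Transposition reverses compositions,
  so each bimodule identity on \<open>V\<^sup>*\<close> becomes an identity between compositions on \<open>V\<close>. The
  key point is that \<open>l\<^sub>L\<close> and \<open>r\<^sub>R\<close> annihilate the images of \<open>l\<^sub>R - l\<^sub>L\<close> and
  \<open>r\<^sub>L - r\<^sub>R\<close>. The dialgebra on \<open>A \<times> V\<^sup>*\<close> is the semidirect product with this bimodule, and (c) is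
  (a) applied to it.
\<close>

section \<open>Finite-dimensional carriers, their duals and products\<close>

lemma (in fd_space) carrier_subspace: "subspace V"
  using finite_spanning_set by auto

lemma (in fd_space) carrier_closed:
  "0 \<in> V" "x \<in> V \<Longrightarrow> y \<in> V \<Longrightarrow> x + y \<in> V" "x \<in> V \<Longrightarrow> y \<in> V \<Longrightarrow> x - y \<in> V"
  "x \<in> V \<Longrightarrow> - x \<in> V" "x \<in> V \<Longrightarrow> scale c x \<in> V"
  using carrier_subspace by (auto intro: subspace_0 subspace_add subspace_diff subspace_neg subspace_scale)

lemma (in fd_space) finite_basis:
  obtains B where "finite B" "independent B" "span B = V"
proof -
  obtain T where T: "finite T" "span T = V"
    using finite_spanning_set by blast
  \<comment> \<open>A maximal independent subset of \<open>V\<close> spans \<open>V\<close>; it is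
    finite because it lies in the span of the finite set \<open>T\<close>.\<close>
  obtain B where B: "B \<subseteq> V" "independent B" "V \<subseteq> span B"
    by (rule maximal_independent_subset)
  show thesis
  proof
    show "finite B"
      using independent_span_bound[OF T(1) B(2)] B(1) T(2) by simp
    show "independent B" by fact
    show "span B = V"
      using B carrier_subspace by (simp add: span_subspace)
  qed
qed

lemma vector_space_scale_fun: "vector_space (scale_fun :: 'f::field_char_0 \<Rightarrow> ('v \<Rightarrow> 'f) \<Rightarrow> 'v \<Rightarrow> 'f)"
  by unfold_locales (auto simp: scale_fun_def algebra_simps fun_eq_iff)

context fd_space
begin

text \<open>Since \<open>f\<close> is linear only on \<open>V\<close>, the induction also uses that
  the partial sums stay in \<open>V\<close>.\<close>

lemma linear_form_sum:
  assumes f: "f \<in> dual_space scale V" and "finite B" "B \<subseteq> V"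
  shows "f (\<Sum>b\<in>B. scale (c b) b) = (\<Sum>b\<in>B. c b * f b)"
  using \<open>finite B\<close> \<open>B \<subseteq> V\<close>
proof (induction B)
  case empty
  have "f (scale 0 0) = 0 * f 0"
    using f carrier_closed(1) unfolding dual_space_def linear_on_def by blast
  then show ?case by simp
next
  case (insert b B)
  have "(\<Sum>b\<in>B. scale (c b) b) \<in> V"
    using insert.prems carrier_subspace by (auto intro!: subspace_sum subspace_scale)
  then show ?case
    using insert f carrier_closed(5) unfolding dual_space_def linear_on_def by auto
qed

lemma subspace_dual_space: "module.subspace scale_fun (dual_space scale V)"
proof -
  interpret F: vector_space "scale_fun :: 'f \<Rightarrow> ('v \<Rightarrow> 'f) \<Rightarrow> 'v \<Rightarrow> 'f"
    by (rule vector_space_scale_fun)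
  show ?thesis
    unfolding F.subspace_def dual_space_def linear_on_def scale_fun_def
    by (auto simp: algebra_simps)
qed

lemma fd_space_dual_space: "fd_space scale_fun (dual_space scale V)"
proof -
  interpret F: vector_space "scale_fun :: 'f \<Rightarrow> ('v \<Rightarrow> 'f) \<Rightarrow> 'v \<Rightarrow> 'f"
    by (rule vector_space_scale_fun)
  obtain B where B: "finite B" "independent B" "span B = V"
    by (rule finite_basis)
  \<comment> \<open>The dual basis: \<open>e b\<close> is the coordinate at \<open>b\<close>, cut
    off to \<open>0\<close> outside \<open>V\<close> so that it lies in
    \<open>dual_space scale V\<close>.\<close>
  define e where "e b = (\<lambda>v. if v \<in> V then representation B v b else 0)" for b
  have e: "e b \<in> dual_space scale V" for b
    using B carrier_closed unfolding dual_space_def linear_on_def e_def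
    by (auto simp: representation_add representation_scale)
  have "f \<in> F.span (e ` B)" if f: "f \<in> dual_space scale V" for f
  proof -
    \<comment> \<open>A form is determined by its values on the basis; outside \<open>V\<close> both
      sides vanish.\<close>
    have f_eq: "f v = (\<Sum>b\<in>B. f b * e b v)" for v
    proof (cases "v \<in> V")
      case True
      have "B \<subseteq> V"
        using B(3) span_superset by blast
      have "f v = f (\<Sum>b\<in>B. scale (representation B v b) b)"
        using B True by (simp add: sum_representation_eq)
      also have "\<dots> = (\<Sum>b\<in>B. f b * e b v)"
        using linear_form_sum[OF f B(1) \<open>B \<subseteq> V\<close>] True by (simp add: e_def mult.commute)
      finally show ?thesis .
    next
      case False
      then show ?thesis using f by (simp add: dual_space_def e_def)
    qed
    have sum_eq: "(\<Sum>b\<in>B. scale_fun (f b) (e b)) v = (\<Sum>b\<in>B. f b * e b v)" for v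
      using B(1) by induction (auto simp: scale_fun_def)
    have "f = (\<Sum>b\<in>B. scale_fun (f b) (e b))"
      by (rule ext) (rule trans[OF f_eq sum_eq[symmetric]])
    also have "\<dots> \<in> F.span (e ` B)"
      by (intro F.span_sum F.span_scale F.span_base imageI)
    finally show ?thesis .
  qed
  moreover have "F.span (e ` B) \<subseteq> dual_space scale V"
    using e subspace_dual_space by (intro F.span_minimal) auto
  ultimately have "F.span (e ` B) = dual_space scale V" by blast
  then have "\<exists>C. finite C \<and> F.span C = dual_space scale V"
    using B(1) by blast
  then show ?thesis
    by unfold_locales
qed

end

lemma fd_space_Times:
  assumes "fd_space sV V" "fd_space sW W"
  shows "fd_space (module_prod.scale sV sW) (V \<times> W)"
proof -
  interpret V: fd_space sV V by fact
  interpret W: fd_space sW W by fact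
  interpret P: vector_space_prod sV sW ..
  obtain B C where "finite B" "V.span B = V" "finite C" "W.span C = W"
    using V.finite_spanning_set W.finite_spanning_set by blast
  \<comment> \<open>The two sets span \<open>V \<times> {0}\<close> and
    \<open>{0} \<times> W\<close>, whose sum is the whole product.\<close>
  then have "P.p.span (B \<times> {0} \<union> {0} \<times> C) = V \<times> W" "finite (B \<times> {0} \<union> {0} \<times> C)"
    by (auto simp: P.p.span_Un P.span_Times_sing1 P.span_Times_sing2)
  then have "\<exists>D. finite D \<and> P.p.span D = V \<times> W"
    by blast
  then show ?thesis
    by unfold_locales
qed

section \<open>Linear maps into endomorphisms, and the laws as rewrite rules\<close>

lemma linear_into_EndD:
  assumes "linear_into_End sA A sV V \<phi>"
  shows "x \<in> A \<Longrightarrow> v \<in> V \<Longrightarrow> \<phi> x v \<in> V"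
    and "x \<in> A \<Longrightarrow> v \<in> V \<Longrightarrow> w \<in> V \<Longrightarrow> \<phi> x (v + w) = \<phi> x v + \<phi> x w"
    and "x \<in> A \<Longrightarrow> v \<in> V \<Longrightarrow> \<phi> x (sV c v) = sV c (\<phi> x v)"
    and "x \<in> A \<Longrightarrow> y \<in> A \<Longrightarrow> v \<in> V \<Longrightarrow> \<phi> (x + y) v = \<phi> x v + \<phi> y v"
    and "x \<in> A \<Longrightarrow> v \<in> V \<Longrightarrow> \<phi> (sA c x) v = sV c (\<phi> x v)"
  using assms unfolding linear_into_End_def linear_on_def by blast+

context fd_space
begin

lemma linear_into_End_0: "linear_into_End sA A scale V 0"
  using carrier_closed unfolding linear_into_End_def linear_on_def by simp

lemma linear_into_End_uminus:
  "linear_into_End sA A scale V \<phi> \<Longrightarrow> linear_into_End sA A scale V (- \<phi>)"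
  using carrier_closed unfolding linear_into_End_def linear_on_def by simp

lemma linear_into_End_diff:
  "linear_into_End sA A scale V \<phi> \<Longrightarrow> linear_into_End sA A scale V \<psi>
    \<Longrightarrow> linear_into_End sA A scale V (\<phi> - \<psi>)"
  using carrier_closed unfolding linear_into_End_def linear_on_def by (simp add: algebra_simps)

lemma linear_into_End_dual_map:
  assumes "linear_into_End sA A scale V \<phi>"
  shows "linear_into_End sA A scale_fun (dual_space scale V) (dual_map V \<phi>)"
  using assms carrier_closed
  unfolding linear_into_End_def linear_on_def dual_space_def dual_map_def scale_fun_def
  by (auto simp: fun_eq_iff)

end

text \<open>Used when one side of a bimodule is replaced by \<open>0\<close>: an action is then
  applied to the zero vector.\<close>

lemma (in fd_space) linear_into_End_apply_0:
  assumes "linear_into_End sA A scale V \<phi>" "x \<in> A"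
  shows "\<phi> x 0 = 0"
  using linear_into_EndD(3)[OF assms carrier_closed(1), of 0] by simp

lemma (in assoc_algebra) mult_closed: "x \<in> A \<Longrightarrow> y \<in> A \<Longrightarrow> mult x y \<in> A"
  using linear_right unfolding linear_on_def by blast

lemma (in assoc_algebra) mult_linear:
  assumes "x \<in> A" "y \<in> A" "z \<in> A"
  shows "mult x (y + z) = mult x y + mult x z" "mult (x + y) z = mult x z + mult y z"
    "mult x (scale c y) = scale c (mult x y)" "mult (scale c x) y = scale c (mult x y)"
  using assms linear_right linear_left unfolding linear_on_def by blast+

text \<open>The locale assumptions carry no names; as numbered facts they can be oriented
  individually.\<close>

lemma (in assoc_bimodule) bimodule_laws:
  shows linear_l: "linear_into_End sA A sV V l"
    and linear_r: "linear_into_End sA A sV V r"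
    and "\<lbrakk>x \<in> A; y \<in> A; v \<in> V\<rbrakk> \<Longrightarrow> l (mult x y) v = l x (l y v)"
    and "\<lbrakk>x \<in> A; y \<in> A; v \<in> V\<rbrakk> \<Longrightarrow> r (mult x y) v = r y (r x v)"
    and "\<lbrakk>x \<in> A; y \<in> A; v \<in> V\<rbrakk> \<Longrightarrow> l x (r y v) = r y (l x v)"
  using assoc_bimodule.axioms(3)[OF assoc_bimodule_axioms]
  unfolding assoc_bimodule_axioms_def by meson+

lemma (in dialgebra) dialgebra_laws:
  shows "\<lbrakk>x \<in> A; y \<in> A; z \<in> A\<rbrakk> \<Longrightarrow> (x \<lhd> y) \<lhd> z = x \<lhd> (y \<rhd> z)"
    and "\<lbrakk>x \<in> A; y \<in> A; z \<in> A\<rbrakk> \<Longrightarrow> (x \<rhd> y) \<lhd> z = x \<rhd> (y \<lhd> z)"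
    and "\<lbrakk>x \<in> A; y \<in> A; z \<in> A\<rbrakk> \<Longrightarrow> (x \<lhd> y) \<rhd> z = x \<rhd> (y \<rhd> z)"
  using dialgebra.axioms(3)[OF dialgebra_axioms] unfolding dialgebra_axioms_def by meson+

section \<open>Bimodules and dialgebras derived from a dialgebra bimodule\<close>

context dialgebra_bimodule
begin

lemma mixed_laws:
  shows "\<lbrakk>x \<in> A; y \<in> A; v \<in> V\<rbrakk> \<Longrightarrow> r\<^sub>L (x \<lhd> y) v = r\<^sub>L (x \<rhd> y) v"
    and "\<lbrakk>x \<in> A; y \<in> A; v \<in> V\<rbrakk> \<Longrightarrow> l\<^sub>L x (r\<^sub>L y v) = l\<^sub>L x (r\<^sub>R y v)"
    and "\<lbrakk>x \<in> A; y \<in> A; v \<in> V\<rbrakk> \<Longrightarrow> l\<^sub>L x (l\<^sub>L y v) = l\<^sub>L x (l\<^sub>R y v)"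
    and "\<lbrakk>x \<in> A; y \<in> A; v \<in> V\<rbrakk> \<Longrightarrow> r\<^sub>L x (r\<^sub>R y v) = r\<^sub>R (y \<lhd> x) v"
    and "\<lbrakk>x \<in> A; y \<in> A; v \<in> V\<rbrakk> \<Longrightarrow> r\<^sub>L x (l\<^sub>R y v) = l\<^sub>R y (r\<^sub>L x v)"
    and "\<lbrakk>x \<in> A; y \<in> A; v \<in> V\<rbrakk> \<Longrightarrow> l\<^sub>L (x \<rhd> y) v = l\<^sub>R x (l\<^sub>L y v)"
    and "\<lbrakk>x \<in> A; y \<in> A; v \<in> V\<rbrakk> \<Longrightarrow> r\<^sub>R x (r\<^sub>L y v) = r\<^sub>R x (r\<^sub>R y v)"
    and "\<lbrakk>x \<in> A; y \<in> A; v \<in> V\<rbrakk> \<Longrightarrow> r\<^sub>R x (l\<^sub>L y v) = r\<^sub>R x (l\<^sub>R y v)"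
    and "\<lbrakk>x \<in> A; y \<in> A; v \<in> V\<rbrakk> \<Longrightarrow> l\<^sub>R (x \<lhd> y) v = l\<^sub>R (x \<rhd> y) v"
  using dialgebra_bimodule.axioms(4)[OF dialgebra_bimodule_axioms]
  unfolding dialgebra_bimodule_axioms_def by meson+

text \<open>
  The laws oriented as a terminating rewrite system: products are expanded, left actions are moved
  outwards, and an \<open>L\<close>-action directly inside \<open>l\<^sub>L\<close> or \<open>r\<^sub>R\<close> is turned into the \<open>R\<close>-action.
\<close>

lemmas normalize =
  RV.bimodule_laws(3,4) RV.bimodule_laws(5)[symmetric]
  LV.bimodule_laws(3,4) LV.bimodule_laws(5)[symmetric]
  mixed_laws(1)[symmetric] mixed_laws(2,3) mixed_laws(4)[symmetric] mixed_laws(5-9)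

lemmas action_linear =
  linear_into_EndD[OF RV.linear_l] linear_into_EndD[OF RV.linear_r]
  linear_into_EndD[OF LV.linear_l] linear_into_EndD[OF LV.linear_r]

lemmas action_0 =
  RV.linear_into_End_apply_0[OF RV.linear_l] RV.linear_into_End_apply_0[OF RV.linear_r]
  RV.linear_into_End_apply_0[OF LV.linear_l] RV.linear_into_End_apply_0[OF LV.linear_r]

text \<open>In each identity a right action occurs on both sides or on neither. With right actions
  \<open>0\<close>, both sides vanish in the first case, and in the second the identity is an
  original law. The same holds with left and right exchanged.\<close>

lemma left_bimodule: "dialgebra_bimodule sA A (\<rhd>) (\<lhd>) sV V l\<^sub>R 0 l\<^sub>L 0"
  by unfold_locales
    (auto simp: RV.linear_l LV.linear_l RV.linear_into_End_0 action_0 normalize action_linear)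

lemma right_bimodule: "dialgebra_bimodule sA A (\<rhd>) (\<lhd>) sV V 0 r\<^sub>R 0 r\<^sub>L"
  by unfold_locales
    (auto simp: RV.linear_r LV.linear_r RV.linear_into_End_0 action_0 normalize action_linear)

lemma dual_bimodule:
  "dialgebra_bimodule sA A (\<rhd>) (\<lhd>) scale_fun (dual_space sV V)
    (- dual_map V r\<^sub>L) (dual_map V l\<^sub>L - dual_map V l\<^sub>R)
    (dual_map V r\<^sub>R - dual_map V r\<^sub>L) (- dual_map V l\<^sub>R)"
proof -
  interpret D: fd_space scale_fun "dual_space sV V"
    by (rule RV.fd_space_dual_space)
  note linear = RV.linear_into_End_dual_map[OF RV.linear_l] RV.linear_into_End_dual_map[OF RV.linear_r]
    RV.linear_into_End_dual_map[OF LV.linear_l] RV.linear_into_End_dual_map[OF LV.linear_r]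
  \<comment> \<open>Closure of \<open>V\<close> under the actions resolves the \<open>if\<close> in
    \<open>dual_map\<close>. At a fixed \<open>u\<close> in \<open>V\<close> both sides are signed
    sums of values of \<open>f\<close>, which agree after cancellation once \<open>normalize\<close>
    has rewritten the arguments.\<close>
  show ?thesis
    by unfold_locales
      (auto intro!: D.linear_into_End_uminus D.linear_into_End_diff linear
        simp: fun_eq_iff dual_map_def action_linear(1,6,11,16) normalize R.mult_closed L.mult_closed)
qed

text \<open>The second components are sums of three terms, one for each factor's vector from
  \<open>V\<close>; comparing them term by term reduces each dialgebra identity to bimodule
  laws.\<close>

lemma semidirect_product:
  "dialgebra (module_prod.scale sA sV) (A \<times> V)
    (\<lambda>(x, u) (y, v). (x \<rhd> y, l\<^sub>R x v + r\<^sub>R y u))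
    (\<lambda>(x, u) (y, v). (x \<lhd> y, l\<^sub>L x v + r\<^sub>L y u))"
proof -
  interpret P: vector_space_prod sA sV ..
  interpret P: fd_space P.scale "A \<times> V"
    by (intro fd_space_Times R.fd_space_axioms RV.fd_space_axioms)
  \<comment> \<open>Rewriting with \<open>dialgebra_laws\<close> turns
    \<open>(x \<lhd> y) \<lhd> z\<close> into \<open>x \<lhd> (y \<rhd> z)\<close>, so associativity
    of \<open>\<lhd>\<close> amounts to this equation.\<close>
  have LL: "x \<lhd> (y \<lhd> z) = x \<lhd> (y \<rhd> z)" if "x \<in> A" "y \<in> A" "z \<in> A" for x y z
    using that L.assoc dialgebra_laws(1) by simp
  show ?thesis
    by unfold_locales
      (clarsimp simp: linear_on_def P.scale_def R.mult_closed L.mult_closed R.mult_linear L.mult_linear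
        R.assoc dialgebra_laws LL normalize action_linear RV.carrier_closed
        R.carrier_closed R.scale_right_distrib RV.scale_right_distrib ac_simps)+
qed

end

theorem lemma2p14:
  fixes sA :: "'f::field_char_0 \<Rightarrow> 'a::ab_group_add \<Rightarrow> 'a" and A :: "'a set"
    and rmult :: "'a \<Rightarrow> 'a \<Rightarrow> 'a"  (infixl "\<rhd>" 70)
    and lmult :: "'a \<Rightarrow> 'a \<Rightarrow> 'a"  (infixl "\<lhd>" 70)
    and sV :: "'f \<Rightarrow> 'v::ab_group_add \<Rightarrow> 'v" and V :: "'v set"
    and l\<^sub>R r\<^sub>R l\<^sub>L r\<^sub>L :: "'a \<Rightarrow> 'v \<Rightarrow> 'v"
  assumes "dialgebra_bimodule sA A (\<rhd>) (\<lhd>) sV V l\<^sub>R r\<^sub>R l\<^sub>L r\<^sub>L"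
  shows
    "(dialgebra_bimodule sA A (\<rhd>) (\<lhd>) sV V l\<^sub>R 0 l\<^sub>L 0 \<and>
      dialgebra_bimodule sA A (\<rhd>) (\<lhd>) sV V 0 r\<^sub>R 0 r\<^sub>L) \<and>
     (dialgebra_bimodule sA A (\<rhd>) (\<lhd>) scale_fun (dual_space sV V)
        (- dual_map V r\<^sub>L) (dual_map V l\<^sub>L - dual_map V l\<^sub>R)
        (dual_map V r\<^sub>R - dual_map V r\<^sub>L) (- dual_map V l\<^sub>R) \<and>
      dialgebra (module_prod.scale sA scale_fun) (A \<times> dual_space sV V)
        (\<lambda>(x, f) (y, g). (x \<rhd> y, - dual_map V r\<^sub>L x g + (dual_map V l\<^sub>L - dual_map V l\<^sub>R) y f))
        (\<lambda>(x, f) (y, g). (x \<lhd> y, (dual_map V r\<^sub>R - dual_map V r\<^sub>L) x g - dual_map V l\<^sub>R y f))) \<and>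
     (dialgebra_bimodule sA A (\<rhd>) (\<lhd>) scale_fun (dual_space sV V)
        0 (dual_map V l\<^sub>L - dual_map V l\<^sub>R) 0 (- dual_map V l\<^sub>R) \<and>
      dialgebra_bimodule sA A (\<rhd>) (\<lhd>) scale_fun (dual_space sV V)
        (- dual_map V r\<^sub>L) 0 (dual_map V r\<^sub>R - dual_map V r\<^sub>L) 0)"
proof -
  interpret B: dialgebra_bimodule sA A "(\<rhd>)" "(\<lhd>)" sV V l\<^sub>R r\<^sub>R l\<^sub>L r\<^sub>L
    by fact
  interpret D: dialgebra_bimodule sA A "(\<rhd>)" "(\<lhd>)" scale_fun "dual_space sV V"
    "- dual_map V r\<^sub>L" "dual_map V l\<^sub>L - dual_map V l\<^sub>R"
    "dual_map V r\<^sub>R - dual_map V r\<^sub>L" "- dual_map V l\<^sub>R"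
    by (rule B.dual_bimodule)
  \<comment> \<open>The product from \<open>D.semidirect_product\<close> adds
    \<open>(- dual_map V l\<^sub>R) y f\<close> where the claim subtracts; simplification identifies
    the two.\<close>
  show ?thesis
    using B.left_bimodule B.right_bimodule D.dialgebra_bimodule_axioms D.semidirect_product
      D.left_bimodule D.right_bimodule
    by simp
qed

end
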